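(* Let $p$ be a prime and $n$ a positive integer with $p^n\equiv 1\pmod 3$. Let $s=\frac{p^n-1}{3}$ and let $\zeta$ be an element of $\mathbb{F}_{p^n}$ of (multiplicative) order $3$. Then $$f(x)=x(x^s-\zeta)(x^s-\zeta^2)+x^3(x^s-1)(x^s-\zeta^2)+\zeta x^p(x^s-1)(x^s-\zeta)$$ is a permutation polynomial over $\mathbb{F}_{p^n}$ if and only if (a) $p\equiv 1\pmod 3$ and $s\equiv 1\pmod 3$; or (b) $p\equiv 2\pmod 3$ and $s\equiv 2\pmod 3$.
   Context: A polynomial is a permutation polynomial (PP) over a finite field if it induces a bijection of that field to itself. *)

theory Defs
  imports "HOL-Library.Cardinality" "HOL-Number_Theory.Number_Theory"
    "HOL-Computational_Algebra.Polynomial"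
begin

definition permutation_poly :: "'a :: {field, finite} poly \<Rightarrow> bool" where
  "permutation_poly f \<longleftrightarrow> bij (poly f)"

(* The value 0 encodes "no finite order"; over a finite field this happens only for z = 0. *)
definition mult_order :: "'a :: field \<Rightarrow> nat" where
  "mult_order z = (if \<exists>k>0. z ^ k = 1 then LEAST k. k > 0 \<and> z ^ k = 1 else 0)"

end

theory Submission
  imports Defs
begin

text \<open>
  Split the nonzero elements according to the value \<open>1\<close>, \<open>\<zeta>\<close> or \<open>\<zeta>\<^sup>2\<close> of \<open>x ^ s\<close>. On the three
  classes \<open>f\<close> restricts to the monomials \<open>3 x\<close>, \<open>3 \<zeta>\<^sup>2 x\<^sup>3\<close> and \<open>3 \<zeta>\<^sup>2 x ^ p\<close>, and \<open>f x / 3\<close> lies in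
  the class of \<open>1\<close>, \<open>\<zeta> ^ (2 s)\<close> and \<open>\<zeta> ^ (2 s + 2 p)\<close> respectively. Cubing is injective on the
  middle class iff \<open>3\<close> does not divide \<open>s\<close>, and \<open>x ^ p\<close> is always injective; so \<open>f\<close> permutes
  the field iff in addition the three image classes are distinct.
\<close>

section \<open>Multiplicative order and power maps on finite fields\<close>

lemma mult_order_eq_3:
  fixes z :: "'a :: field"
  assumes "mult_order z = 3"
  shows "z ^ 3 = 1" and "z \<noteq> 1"
proof -
  have ex: "\<exists>k>0. z ^ k = 1" and least: "(LEAST k. k > 0 \<and> z ^ k = 1) = 3"
    using assms by (auto simp: mult_order_def split: if_splits)
  show "z ^ 3 = 1" using LeastI_ex[OF ex] least by simp
  show "z \<noteq> 1" using not_less_Least[of 1 "\<lambda>k. k > 0 \<and> z ^ k = 1"] least by auto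
qed

text \<open>Multiplication by \<open>x\<close> permutes the nonzero elements, so it leaves their
  product unchanged; cancel that product.\<close>

lemma field_power_card_minus_1:
  fixes x :: "'a :: {field, finite}"
  assumes "x \<noteq> 0"
  shows "x ^ (CARD('a) - 1) = 1"
proof -
  let ?U = "UNIV - {0 :: 'a}"
  have "(\<Prod>y\<in>?U. x * y) = \<Prod>?U"
    by (rule prod.reindex_bij_witness[of _ "\<lambda>y. y / x" "\<lambda>y. x * y"]) (use assms in auto)
  then have "x ^ card ?U * \<Prod>?U = \<Prod>?U"
    by (simp add: prod.distrib)
  moreover have "\<Prod>?U \<noteq> 0" by simp
  ultimately show ?thesis by (simp add: card_Diff_singleton)
qed

lemma field_power_card:
  fixes x :: "'a :: {field, finite}"
  shows "x ^ CARD('a) = x"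
proof (cases "x = 0")
  case False
  have "CARD('a) = Suc (CARD('a) - 1)"
    using zero_less_card_finite[where 'a = 'a] by linarith
  then have "x ^ CARD('a) = x * x ^ (CARD('a) - 1)"
    by (metis power_Suc)
  then show ?thesis using field_power_card_minus_1[OF False] by simp
qed simp

text \<open>Raising further to the power \<open>p ^ (n - 1)\<close> yields the power
  \<open>CARD('a)\<close>, which is the identity: the map has a left inverse.\<close>

lemma inj_power_card_root:
  fixes p n :: nat
  assumes "CARD('a :: {field, finite}) = p ^ n" and "n > 0"
  shows "inj (\<lambda>x :: 'a. x ^ p)"
proof (rule injI)
  fix x y :: 'a
  assume "x ^ p = y ^ p"
  then have "(x ^ p) ^ p ^ (n - 1) = (y ^ p) ^ p ^ (n - 1)" by simp
  moreover have "p * p ^ (n - 1) = CARD('a)"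
    using assms by (cases n) auto
  ultimately show "x = y" by (simp flip: power_mult add: field_power_card)
qed

text \<open>Otherwise \<open>X ^ s - 1\<close> would have more roots than its degree allows. This
  supplies an element outside the class of \<open>1\<close>.\<close>

lemma ex_power_neq_1:
  fixes s :: nat
  assumes "0 < s" and "s < CARD('a :: {field, finite}) - 1"
  shows "\<exists>u :: 'a. u \<noteq> 0 \<and> u ^ s \<noteq> 1"
proof (rule ccontr)
  assume "\<not> ?thesis"
  then have sub: "UNIV - {0} \<subseteq> {x. poly (monom 1 s - 1 :: 'a poly) x = 0}"
    by (auto simp: poly_monom)
  have deg: "degree (monom 1 s - 1 :: 'a poly) \<le> s"
    by (intro degree_diff_le) (auto simp: degree_monom_le)
  have "coeff (monom 1 s - 1 :: 'a poly) s \<noteq> 0"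
    using assms(1) by (simp add: coeff_1)
  then have "(monom 1 s - 1 :: 'a poly) \<noteq> 0"
    by (metis coeff_0)
  then have "card {x. poly (monom 1 s - 1 :: 'a poly) x = 0} \<le> s"
    using card_poly_roots_bound deg le_trans by blast
  moreover have "card (UNIV - {0 :: 'a}) \<le> card {x. poly (monom 1 s - 1 :: 'a poly) x = 0}"
    by (rule card_mono[OF _ sub]) simp
  ultimately show False using assms(2) by (simp add: card_Diff_singleton)
qed

section \<open>Arithmetic with a primitive cube root of unity\<close>

locale cube_root_of_unity =
  fixes \<zeta> :: "'a :: field"
  assumes cube: "\<zeta> ^ 3 = 1" and neq_1: "\<zeta> \<noteq> 1"
begin

lemma sum_zero: "\<zeta>\<^sup>2 + \<zeta> + 1 = 0"
proof -
  have "(\<zeta> - 1) * (\<zeta>\<^sup>2 + \<zeta> + 1) = \<zeta> ^ 3 - 1"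
    by (simp add: algebra_simps power2_eq_square power3_eq_cube)
  then show ?thesis using cube neq_1 by simp
qed

text \<open>Oriented as rewrite rules, these lower every polynomial in \<open>\<zeta>\<close> to
  degree at most one; the second form catches products nested to the right.\<close>

lemma reduce:
  shows "\<zeta> * \<zeta> = - \<zeta> - 1" and "\<zeta> * (\<zeta> * x) = - (\<zeta> * x) - x"
proof -
  show *: "\<zeta> * \<zeta> = - \<zeta> - 1"
    using sum_zero by (simp add: power2_eq_square eq_neg_iff_add_eq_0 algebra_simps)
  show "\<zeta> * (\<zeta> * x) = - (\<zeta> * x) - x"
    unfolding mult.assoc[symmetric] * by (simp add: algebra_simps)
qed

lemmas reduce_simps = algebra_simps power2_eq_square power3_eq_cube reduce

lemma nonzero: "\<zeta> \<noteq> 0"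
  using cube by auto

lemma square_neq_1: "\<zeta>\<^sup>2 \<noteq> 1"
  using cube neq_1 by (auto simp: power3_eq_cube power2_eq_square)

lemma square_neq: "\<zeta>\<^sup>2 \<noteq> \<zeta>"
  using nonzero neq_1 by (simp add: power2_eq_square)

lemma three_neq_0: "(3 :: 'a) \<noteq> 0"
proof -
  \<comment> \<open>This is \<open>X\<^sup>2 + X + 1\<close>, with roots \<open>\<zeta>\<close> and
    \<open>\<zeta>\<^sup>2\<close>, evaluated at \<open>1\<close>.\<close>
  have "(1 - \<zeta>) * (1 - \<zeta>\<^sup>2) = 3" by (simp add: reduce_simps)
  then show ?thesis using neq_1 square_neq_1 by auto
qed

lemma power_mod_3: "\<zeta> ^ k = \<zeta> ^ (k mod 3)"
proof -
  have "\<zeta> ^ k = \<zeta> ^ (3 * (k div 3) + k mod 3)" by simp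
  also have "\<dots> = \<zeta> ^ (k mod 3)" unfolding power_add power_mult cube by simp
  finally show ?thesis .
qed

lemma power_eq_1_iff: "\<zeta> ^ k = 1 \<longleftrightarrow> 3 dvd k"
proof -
  have "k mod 3 = 0 \<or> k mod 3 = 1 \<or> k mod 3 = 2" by auto
  then show ?thesis
    using neq_1 square_neq_1 by (subst power_mod_3) (auto simp: dvd_eq_mod_eq_0)
qed

lemma cube_eq_1_cases:
  assumes "y ^ 3 = 1"
  obtains "y = 1" | "y = \<zeta>" | "y = \<zeta>\<^sup>2"
proof -
  have "(y - 1) * ((y - \<zeta>) * (y - \<zeta>\<^sup>2)) = y ^ 3 - 1"
    by (simp add: reduce_simps)
  then show thesis using that assms by auto
qed

lemma cube_eq_cube_cases:
  assumes "x ^ 3 = y ^ 3"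
  obtains k where "y = \<zeta> ^ k * x"
proof (cases "x = 0")
  case False
  then have "(y / x) ^ 3 = 1"
    using assms by (auto simp: power_divide)
  then obtain k where "y / x = \<zeta> ^ k"
    using power_0[of \<zeta>] power_one_right[of \<zeta>] by (metis cube_eq_1_cases)
  with False have "y = \<zeta> ^ k * x" by (simp add: field_simps)
  then show thesis by (rule that)
qed (use assms that[of 0] in simp)

text \<open>Here \<open>y\<close> stands for \<open>x ^ s\<close>. At each cube root of unity two of
  the three summands vanish, and the surviving coefficient is \<open>3\<close> or
  \<open>3 * \<zeta>\<^sup>2\<close>.\<close>

lemma branch_values:
  defines "F \<equiv> \<lambda>(p :: nat) x y. x * (y - \<zeta>) * (y - \<zeta>\<^sup>2) + x ^ 3 * (y - 1) * (y - \<zeta>\<^sup>2)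
             + \<zeta> * x ^ p * (y - 1) * (y - \<zeta>)"
  shows "F p x 1 = 3 * x" and "F p x \<zeta> = 3 * (\<zeta>\<^sup>2 * x ^ 3)" and "F p x (\<zeta>\<^sup>2) = 3 * (\<zeta>\<^sup>2 * x ^ p)"
  unfolding F_def by (simp_all add: reduce_simps)

end

theorem theorem2p21:
  fixes p n s :: nat and \<zeta> :: "'a :: {field, finite}" and X f :: "'a poly"
  assumes "prime p" and "n > 0" and "CARD('a) = p ^ n"
    and "[p ^ n = 1] (mod 3)"
    and "s = (p ^ n - 1) div 3"
    and "mult_order \<zeta> = 3"
    and "X = [:0, 1:]"
    and "f = X * (X ^ s - [:\<zeta>:]) * (X ^ s - [:\<zeta>\<^sup>2:])
           + X ^ 3 * (X ^ s - 1) * (X ^ s - [:\<zeta>\<^sup>2:])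
           + [:\<zeta>:] * X ^ p * (X ^ s - 1) * (X ^ s - [:\<zeta>:])"
  shows "permutation_poly f \<longleftrightarrow>
           ([p = 1] (mod 3) \<and> [s = 1] (mod 3)) \<or> ([p = 2] (mod 3) \<and> [s = 2] (mod 3))"
proof -
  interpret cube_root_of_unity \<zeta>
    by unfold_locales (use mult_order_eq_3 assms(6) in auto)
  have p1: "p > 1" using assms(1) prime_gt_1_nat by blast
  then have q1: "p ^ n > 1" using assms(2) by (rule one_less_power)
  have q_mod: "p ^ n mod 3 = 1" using assms(4) by (simp add: cong_def)
  have s3: "p ^ n - 1 = 3 * s" using assms(5) q_mod by presburger
  have s0: "s > 0" using q1 s3 by presburger
  have p_mod: "p mod 3 \<noteq> 0"
  proof
    assume "p mod 3 = 0"
    then have "3 dvd p ^ n" using assms(2) by (meson dvd_power dvd_trans mod_0_imp_dvd)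
    then show False using q_mod by presburger
  qed

  have double: "(2 * k) mod 3 = 2 * (k mod 3) mod 3" for k :: nat
    by (rule mod_mult_right_eq[symmetric])
  have residues: "(2 * s) mod 3 = 2 * (s mod 3) mod 3"
      "(2 * s + 2 * p) mod 3 = (2 * (s mod 3) mod 3 + 2 * (p mod 3) mod 3) mod 3"
    unfolding double[symmetric] mod_add_eq by (rule refl)+

  have cls: "(x ^ s) ^ 3 = 1" if "x \<noteq> 0" for x :: 'a
    using field_power_card_minus_1[OF that] assms(3) s3
    by (simp flip: power_mult add: mult.commute)

  \<comment> \<open>Dividing by \<open>3\<close> keeps injectivity and makes \<open>g\<close> the
    identity on the class of \<open>1\<close>.\<close>
  define g where "g x = poly f x / 3" for x
  have poly_f: "poly f x = x * (x ^ s - \<zeta>) * (x ^ s - \<zeta>\<^sup>2) + x ^ 3 * (x ^ s - 1) * (x ^ s - \<zeta>\<^sup>2)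
             + \<zeta> * x ^ p * (x ^ s - 1) * (x ^ s - \<zeta>)" for x
    by (simp add: assms(7,8))
  have g0: "g 0 = 0" using p1 by (simp add: g_def poly_f power_0_left)
  have g1: "g x = x" if "x ^ s = 1" for x
    unfolding g_def poly_f that branch_values using three_neq_0 by simp
  have g2: "g x = \<zeta>\<^sup>2 * x ^ 3" if "x ^ s = \<zeta>" for x
    unfolding g_def poly_f that branch_values using three_neq_0 by simp
  have g3: "g x = \<zeta>\<^sup>2 * x ^ p" if "x ^ s = \<zeta>\<^sup>2" for x
    unfolding g_def poly_f that branch_values using three_neq_0 by simp
  have bij_iff: "permutation_poly f \<longleftrightarrow> inj g"
  proof -
    have "inj g \<longleftrightarrow> inj (poly f)"
      using three_neq_0 by (simp add: g_def inj_on_def)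
    then show ?thesis
      using finite_UNIV_inj_surj[of "poly f"] by (auto simp: permutation_poly_def bij_def)
  qed

  \<comment> \<open>The factor \<open>(x ^ 3) ^ s\<close> is \<open>(x ^ s) ^ 3 = 1\<close>, so only
    the coefficient contributes.\<close>
  have c2: "g x ^ s = \<zeta> ^ (2 * s)" if "x ^ s = \<zeta>" for x
  proof -
    have "x \<noteq> 0" using that s0 nonzero by (auto simp: power_0_left)
    from cls[OF this] show ?thesis
      unfolding g2[OF that] power_mult_distrib by (simp flip: power_mult add: mult.commute)
  qed
  have c3: "g x ^ s = \<zeta> ^ (2 * s + 2 * p)" if "x ^ s = \<zeta>\<^sup>2" for x
  proof -
    have "(x ^ p) ^ s = \<zeta> ^ (2 * p)"
      using that by (metis power_mult mult.commute)
    then show ?thesis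
      unfolding g3[OF that] power_mult_distrib by (simp flip: power_mult add: power_add)
  qed

  obtain u :: 'a where u: "u \<noteq> 0" "u ^ s \<noteq> 1"
    using ex_power_neq_1[of s, where 'a = 'a] s0 s3 assms(3) by auto
  \<comment> \<open>Either \<open>u\<close> itself or its square lies in the class of
    \<open>\<zeta>\<close>, as \<open>\<zeta> ^ 4 = \<zeta>\<close>. Then the square of
    \<open>a\<close> inhabits the third class.\<close>
  obtain a :: 'a where a: "a ^ s = \<zeta>"
  proof (rule cube_eq_1_cases[OF cls[OF u(1)]])
    assume "u ^ s = \<zeta>\<^sup>2"
    then have "(u\<^sup>2) ^ s = (\<zeta>\<^sup>2)\<^sup>2" by (metis power_mult mult.commute)
    also have "\<dots> = \<zeta>" by (simp add: reduce_simps)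
    finally show thesis by (rule that)
  qed (use u that in auto)
  have b: "(a\<^sup>2) ^ s = \<zeta>\<^sup>2" using a by (metis power_mult mult.commute)

  show ?thesis
  proof
    assume "permutation_poly f"
    then have inj: "inj g" using bij_iff by simp
    \<comment> \<open>If \<open>3\<close> divides \<open>s\<close>, then \<open>\<zeta> * a\<close>
      has the same class and the same cube as \<open>a\<close>, so \<open>g\<close>
      collides.\<close>
    have "s mod 3 \<noteq> 0"
    proof
      assume "s mod 3 = 0"
      then have "\<zeta> ^ s = 1" using power_eq_1_iff by auto
      then have "(\<zeta> * a) ^ s = \<zeta>" using a by (simp add: power_mult_distrib)
      then have "g (\<zeta> * a) = g a" using a g2 cube by (simp add: power_mult_distrib)
      then have "\<zeta> * a = a" using inj by (simp add: inj_eq)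
      then show False using a neq_1 nonzero s0 by (auto simp: power_0_left)
    qed
    \<comment> \<open>Otherwise \<open>g\<close> sends \<open>a\<^sup>2\<close> into the class of
      \<open>1\<close>, where it fixes every point; injectivity then puts \<open>a\<^sup>2\<close>
      in that class.\<close>
    moreover have "\<not> 3 dvd 2 * s + 2 * p"
    proof
      assume "3 dvd 2 * s + 2 * p"
      then have "g (a\<^sup>2) ^ s = 1" using c3[OF b] power_eq_1_iff by simp
      then have "g (g (a\<^sup>2)) = g (a\<^sup>2)" by (rule g1)
      then have "g (a\<^sup>2) = a\<^sup>2" using inj by (simp add: inj_eq)
      then show False using \<open>g (a\<^sup>2) ^ s = 1\<close> b square_neq_1 by simp
    qed
    moreover have "p mod 3 = 1 \<or> p mod 3 = 2" and "s mod 3 = 0 \<or> s mod 3 = 1 \<or> s mod 3 = 2"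
      using p_mod by linarith+
    ultimately show "([p = 1] (mod 3) \<and> [s = 1] (mod 3)) \<or> ([p = 2] (mod 3) \<and> [s = 2] (mod 3))"
      unfolding cong_def dvd_eq_mod_eq_0 residues by auto
  next
    assume "([p = 1] (mod 3) \<and> [s = 1] (mod 3)) \<or> ([p = 2] (mod 3) \<and> [s = 2] (mod 3))"
    then have ps: "(p mod 3 = 1 \<and> s mod 3 = 1) \<or> (p mod 3 = 2 \<and> s mod 3 = 2)"
      by (simp add: cong_def)
    \<comment> \<open>The exponents \<open>0\<close>, \<open>2 * s\<close> and
      \<open>2 * s + 2 * p\<close> are pairwise distinct modulo \<open>3\<close>, hence so are the
      image classes.\<close>
    then have "(2 * s) mod 3 = 2 \<and> (2 * s + 2 * p) mod 3 = 1 \<or>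
               (2 * s) mod 3 = 1 \<and> (2 * s + 2 * p) mod 3 = 2"
      unfolding residues by auto
    then have d: "\<zeta> ^ (2 * s) \<noteq> 1" "\<zeta> ^ (2 * s + 2 * p) \<noteq> 1" "\<zeta> ^ (2 * s) \<noteq> \<zeta> ^ (2 * s + 2 * p)"
      using neq_1 square_neq_1 square_neq power_mod_3[of "2 * s"] power_mod_3[of "2 * s + 2 * p"]
      by auto
    have g_eq_0: "g x = 0 \<longleftrightarrow> x = 0" for x
    proof (cases "x = 0")
      case False
      show ?thesis
        by (rule cube_eq_1_cases[OF cls[OF False]]) (use False nonzero g1 g2 g3 in auto)
    qed (simp add: g0)
    \<comment> \<open>The power \<open>g x ^ s\<close> determines the class of \<open>x\<close>; the
      nine pairs of classes are checked.\<close>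
    have g_class: "x ^ s = y ^ s" if "g x = g y" "x \<noteq> 0" "y \<noteq> 0" for x y
    proof -
      note eq = arg_cong[OF that(1), of "\<lambda>z. z ^ s"]
      show ?thesis
        by (rule cube_eq_1_cases[OF cls[OF that(2)]]; rule cube_eq_1_cases[OF cls[OF that(3)]])
          (use eq d c2 c3 g1 in metis)+
    qed
    have "inj g"
    proof (rule injI)
      fix x y
      assume eq: "g x = g y"
      show "x = y"
      proof (cases "x = 0 \<or> y = 0")
        case True
        then show ?thesis using eq g_eq_0 by metis
      next
        case False
        then have xy: "x \<noteq> 0" "y \<noteq> 0" and same: "y ^ s = x ^ s"
          using g_class[OF eq] by auto
        show ?thesis
        proof (rule cube_eq_1_cases[OF cls[OF xy(1)]])
          assume "x ^ s = 1"
          then show ?thesis using eq g1 same by metis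
        next
          assume x: "x ^ s = \<zeta>"
          then have "x ^ 3 = y ^ 3" using eq g2 same nonzero by simp
          then obtain k where k: "y = \<zeta> ^ k * x" by (rule cube_eq_cube_cases)
          \<comment> \<open>Equal cubes leave a factor \<open>\<zeta> ^ k\<close>; equality of
            classes and \<open>3\<close> not dividing \<open>s\<close> force it to be
            \<open>1\<close>.\<close>
          have "\<zeta> ^ (k * s) * x ^ s = x ^ s"
            using same unfolding k power_mult_distrib by (simp flip: power_mult)
          then have "3 dvd k * s" using xy power_eq_1_iff by simp
          moreover have "\<not> 3 dvd s" using ps by auto
          ultimately have "3 dvd k" by (simp add: prime_dvd_mult_iff)
          then have "\<zeta> ^ k = 1" by (simp add: power_eq_1_iff)
          then show ?thesis using k by simp
        next
          assume x: "x ^ s = \<zeta>\<^sup>2"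
          then have "x ^ p = y ^ p" using eq g3 same nonzero by simp
          then show ?thesis using inj_power_card_root[OF assms(3,2)] by (simp add: inj_def)
        qed
      qed
    qed
    then show "permutation_poly f" using bij_iff by simp
  qed
qed

end
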